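(* For any $p\in(2,\infty)$, any $\theta\in(-\pi/2,\pi/2)$ and any $r\in[1,\infty]$, the operator $\mathcal{L}_\theta f(\rho)=\int_0^\infty f(t)\,e^{-\rho t e^{i\theta}}\,dt$ ($\rho>0$) carries the Lorentz space $L^{p,r}(\mathbb{R}_+)$ into the Lorentz space $L^{p',r}(\mathbb{R}_+)$, where $p^{-1}+p'^{-1}=1$.
   Context: $\mathbb{R}_+=(0,\infty)$ with Lebesgue measure $|\cdot|$. For a measurable $f$ on $\mathbb{R}_+$, the distribution function is $d_f(\lambda)=|\{x:|f(x)|>\lambda\}|$ and the decreasing rearrangement is $|f|^*(t)=\inf\{\lambda\ge0: d_f(\lambda)\le t\}$. For $p\ge1$ and $0<r<\infty$, $L^{p,r}(\mathbb{R}_+)$ is the space of measurable $f$ with $\|f\|_{p,r}^r=\int_0^\infty (t^{1/p}|f|^*(t))^r\,\frac{dt}{t}<\infty$; $L^{p,\infty}(\mathbb{R}_+)$ is the space of measurable $f$ with $\sup_{t>0}t^{1/p}|f|^*(t)<\infty$. *)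

theory Defs
  imports "HOL-Analysis.Analysis"
begin

abbreviation Rplus :: "real measure"
  where "Rplus \<equiv> lebesgue_on {0<..}"

definition distribution_function :: "(real \<Rightarrow> complex) \<Rightarrow> real \<Rightarrow> ennreal"
  where "distribution_function f s = emeasure Rplus {x \<in> space Rplus. norm (f x) > s}"

text \<open>The values lie in \<^typ>\<open>ennreal\<close> so that the infimum of the empty set is infinite
  (over \<^typ>\<open>real\<close> it would be an unspecified finite number).\<close>

definition decreasing_rearrangement :: "(real \<Rightarrow> complex) \<Rightarrow> real \<Rightarrow> ennreal"
  where "decreasing_rearrangement f t =
    Inf {ennreal s |s. s \<ge> 0 \<and> distribution_function f s \<le> ennreal t}"

text \<open>Real powers on \<^typ>\<open>ennreal\<close>, meant for exponents \<open>a > 0\<close>.\<close>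

definition ennreal_powr :: "ennreal \<Rightarrow> real \<Rightarrow> ennreal"
  where "ennreal_powr x a = (if x = \<infinity> then \<infinity> else ennreal (enn2real x powr a))"

text \<open>The second index is meant to range over \<open>0 < r \<le> \<infinity>\<close>.\<close>

definition lorentz_space :: "real \<Rightarrow> ennreal \<Rightarrow> (real \<Rightarrow> complex) set"
  where "lorentz_space p r = {f \<in> borel_measurable Rplus.
    (if r = \<infinity>
     then (SUP t\<in>{0<..}. ennreal (t powr (1 / p)) * decreasing_rearrangement f t) < \<infinity>
     else (\<integral>\<^sup>+ t. ennreal_powr (ennreal (t powr (1 / p)) * decreasing_rearrangement f t)
                     (enn2real r) / ennreal t \<partial>Rplus) < \<infinity>)}"

definition laplace_kernel :: "real \<Rightarrow> real \<Rightarrow> real \<Rightarrow> complex"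
  where "laplace_kernel \<theta> \<rho> t = exp (- (of_real (\<rho> * t) * exp (\<i> * of_real \<theta>)))"

definition laplace_op :: "real \<Rightarrow> (real \<Rightarrow> complex) \<Rightarrow> real \<Rightarrow> complex"
  where "laplace_op \<theta> f \<rho> = (\<integral> t. f t * laplace_kernel \<theta> \<rho> t \<partial>Rplus)"

end

theory Submission imports Defs begin

text \<open>With \<open>c = cos \<theta>\<close>, the Hardy--Littlewood inequality bounds \<open>norm (laplace_op \<theta> f \<rho>)\<close> by the real Laplace
  transform of the decreasing rearrangement of \<open>f\<close> at \<open>c * \<rho>\<close>. This bound is decreasing in \<open>\<rho>\<close>, so it
  also bounds the rearrangement of \<open>laplace_op \<theta> f\<close>. Weighted by a power of \<open>\<rho>\<close>, it is a
  convolution on the multiplicative group \<open>(0, \<infinity>)\<close> of the function defining the Lorentz norm of \<open>f\<close>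
  with a kernel of total mass \<open>Gamma (1 / p')\<close>, and Young's inequality applies.\<close>

section \<open>Measure theory on the half-line\<close>

lemma borel_measurable_antimono_ennreal:
  fixes f :: "real \<Rightarrow> ennreal"
  assumes "antimono f"
  shows "f \<in> borel_measurable borel"
proof (rule borel_measurableI_greater)
  fix y
  have "is_interval {x. y < f x}"
    unfolding is_interval_1 using antimonoD[OF assms] by (auto intro: less_le_trans)
  then show "{x \<in> space borel. y < f x} \<in> sets borel"
    using real_interval_borel_measurable by simp
qed

text \<open>A countable cover by sets of finite measure survives completion. Lebesgue measure is the
  completion of \<open>lborel\<close>, so this opens the way to Fubini on
  \<open>Rplus\<close>.\<close>

lemma sigma_finite_completion:
  assumes "sigma_finite_measure M"
  shows "sigma_finite_measure (completion M)"
proof -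
  interpret sigma_finite_measure M by fact
  from sigma_finite_countable obtain A
    where A: "countable A" "A \<subseteq> sets M" "\<Union>A = space M" "\<forall>a\<in>A. emeasure M a \<noteq> \<infinity>"
    by blast
  show ?thesis
    by (rule sigma_finite_measure.intro, rule exI[of _ A]) (use A in auto)
qed

lemma sigma_finite_Rplus: "sigma_finite_measure Rplus"
  by (rule sigma_finite_measure_restrict_space)
     (auto intro: sigma_finite_completion sigma_finite_lborel)

interpretation Rplus: sigma_finite_measure Rplus
  by (rule sigma_finite_Rplus)

interpretation Rplus_pair: pair_sigma_finite Rplus Rplus ..

lemma space_Rplus: "space Rplus = {0<..}"
  by (simp add: space_restrict_space)

lemma borel_measurable_Rplus [measurable (raw)]:
  assumes "f \<in> borel_measurable borel"
  shows "f \<in> borel_measurable Rplus"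
  using assms by (auto intro!: measurable_restrict_space1 measurable_completion)

lemma ident_Rplus [measurable]: "(\<lambda>x. x) \<in> borel_measurable Rplus"
  by (rule borel_measurable_Rplus) simp

text \<open>Passing to \<open>lborel\<close> gives access to the affine change of variables.\<close>

lemma nn_integral_Rplus: "(\<integral>\<^sup>+t. f t \<partial>Rplus) = (\<integral>\<^sup>+t. f t * indicator {0<..} t \<partial>lborel)"
  by (subst nn_integral_restrict_space) (auto simp: nn_integral_completion)

lemma emeasure_Rplus_Ioo: "0 \<le> b \<Longrightarrow> emeasure Rplus {0<..<b} = ennreal b"
  by (subst emeasure_restrict_space) auto

lemma emeasure_Rplus_Ioc: "0 \<le> b \<Longrightarrow> emeasure Rplus {0<..b} = ennreal b"
  by (subst emeasure_restrict_space) auto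

section \<open>Rearrangements and the Hardy--Littlewood inequality\<close>

text \<open>If \<open>E\<close> has finite measure \<open>m\<close> and \<open>B = {0<..<m}\<close>,
  then \<open>E - B\<close> and \<open>B - E\<close> have equal measure, while \<open>k\<close> is
  at most \<open>k m\<close> on the first and at least \<open>k m\<close> on the second. Exchanging
  them can only increase the integral.\<close>

lemma bathtub:
  fixes k :: "real \<Rightarrow> ennreal"
  assumes k: "antimono k" and E [measurable]: "E \<in> sets Rplus"
  shows "(\<integral>\<^sup>+t. k t * indicator E t \<partial>Rplus)
    \<le> (\<integral>\<^sup>+t. k t * indicator {t. ennreal t < emeasure Rplus E} t \<partial>Rplus)"
proof (cases "emeasure Rplus E" rule: ennreal_cases)
  case top
  have "(\<integral>\<^sup>+t. k t * indicator E t \<partial>Rplus) \<le> (\<integral>\<^sup>+t. k t \<partial>Rplus)"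
    by (intro nn_integral_mono) (auto simp: space_Rplus split: split_indicator)
  then show ?thesis
    by (simp add: top)
next
  case (real m)
  define B where "B = {0<..<m}"
  have [measurable]: "k \<in> borel_measurable Rplus"
    by (rule borel_measurable_Rplus[OF borel_measurable_antimono_ennreal[OF k]])
  have B [measurable]: "B \<in> sets Rplus"
    by (auto simp: B_def sets_restrict_space_iff)
  have "emeasure Rplus B = emeasure Rplus E"
    using real by (simp add: B_def emeasure_Rplus_Ioo)
  moreover have "emeasure Rplus B = emeasure Rplus (E \<inter> B) + emeasure Rplus (B - E)"
    by (subst plus_emeasure) (auto intro!: arg_cong[where f = "emeasure Rplus"])
  moreover have "emeasure Rplus E = emeasure Rplus (E \<inter> B) + emeasure Rplus (E - B)"
    by (subst plus_emeasure) (auto intro!: arg_cong[where f = "emeasure Rplus"])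
  \<comment> \<open>Finiteness is what permits cancelling this term in
    \<open>ennreal\<close>.\<close>
  moreover have "emeasure Rplus (E \<inter> B) \<noteq> \<infinity>"
    using emeasure_mono[of "E \<inter> B" E Rplus] real by (auto simp: top_unique)
  ultimately have eq: "emeasure Rplus (E - B) = emeasure Rplus (B - E)"
    by (metis ennreal_add_left_cancel infinity_ennreal_def)
  have "(\<integral>\<^sup>+t. k t * indicator E t \<partial>Rplus)
      = (\<integral>\<^sup>+t. k t * indicator (E \<inter> B) t \<partial>Rplus) + (\<integral>\<^sup>+t. k t * indicator (E - B) t \<partial>Rplus)"
    by (subst nn_integral_add[symmetric]) (auto intro!: nn_integral_cong split: split_indicator)
  also have "(\<integral>\<^sup>+t. k t * indicator (E - B) t \<partial>Rplus) \<le> (\<integral>\<^sup>+t. k m * indicator (E - B) t \<partial>Rplus)"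
    using sets.sets_into_space[OF E, unfolded space_Rplus]
    by (intro nn_integral_mono) (auto simp: B_def space_Rplus split: split_indicator intro!: antimonoD[OF k])
  also have "\<dots> = (\<integral>\<^sup>+t. k m * indicator (B - E) t \<partial>Rplus)"
    by (simp add: nn_integral_cmult eq)
  also have "\<dots> \<le> (\<integral>\<^sup>+t. k t * indicator (B - E) t \<partial>Rplus)"
    by (intro nn_integral_mono) (auto simp: B_def space_Rplus split: split_indicator intro!: antimonoD[OF k])
  also have "(\<integral>\<^sup>+t. k t * indicator (E \<inter> B) t \<partial>Rplus) + (\<integral>\<^sup>+t. k t * indicator (B - E) t \<partial>Rplus)
      = (\<integral>\<^sup>+t. k t * indicator B t \<partial>Rplus)"
    by (subst nn_integral_add[symmetric]) (auto intro!: nn_integral_cong split: split_indicator)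
  also have "\<dots> = (\<integral>\<^sup>+t. k t * indicator {t. ennreal t < emeasure Rplus E} t \<partial>Rplus)"
    using real by (intro nn_integral_cong) (auto simp: B_def space_Rplus ennreal_less_iff split: split_indicator)
  finally show ?thesis
    by (simp add: add_left_mono)
qed

lemma antimono_distribution_function:
  assumes [measurable]: "f \<in> borel_measurable Rplus"
  shows "antimono (distribution_function f)"
  unfolding distribution_function_def by (intro antimonoI emeasure_mono, force) measurable

lemma antimono_decreasing_rearrangement: "antimono (decreasing_rearrangement f)"
  unfolding decreasing_rearrangement_def
  by (intro antimonoI Inf_superset_mono) (blast intro: order_trans ennreal_leI)

lemma le_decreasing_rearrangement:
  assumes f: "f \<in> borel_measurable Rplus" and "ennreal t < distribution_function f l"
  shows "ennreal l \<le> decreasing_rearrangement f t"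
  unfolding decreasing_rearrangement_def
proof (rule Inf_greatest, clarify)
  fix s assume "distribution_function f s \<le> ennreal t"
  then have "distribution_function f s < distribution_function f l"
    using assms(2) by (rule le_less_trans)
  then have "l \<le> s"
    using antimonoD[OF antimono_distribution_function[OF f], of s l] by (meson leD linear)
  then show "ennreal l \<le> ennreal s"
    by (rule ennreal_leI)
qed

text \<open>Layer-cake argument: \<open>norm (f t)\<close> is written as an integral over levels
  \<open>l\<close>, the integrals are exchanged, \<open>bathtub\<close> is applied at every level,
  and exchanging back leaves an integral over levels bounded by the rearrangement. As
  \<open>k\<close> is already decreasing, it appears unrearranged on the right.\<close>

lemma hardy_littlewood_antimono:
  fixes k :: "real \<Rightarrow> ennreal"
  assumes f [measurable]: "f \<in> borel_measurable Rplus" and k: "antimono k"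
  shows "(\<integral>\<^sup>+t. ennreal (norm (f t)) * k t \<partial>Rplus)
    \<le> (\<integral>\<^sup>+t. decreasing_rearrangement f t * k t \<partial>Rplus)"
proof -
  let ?d = "distribution_function f"
  have [measurable]: "k \<in> borel_measurable borel"
    by (rule borel_measurable_antimono_ennreal[OF k])
  have [measurable]: "?d \<in> borel_measurable borel"
    by (rule borel_measurable_antimono_ennreal[OF antimono_distribution_function[OF f]])
  have layer: "(\<integral>\<^sup>+l. indicator {l. l < b} l \<partial>Rplus) = ennreal b" if "0 \<le> b" for b
  proof -
    have "(\<integral>\<^sup>+l. indicator {l. l < b} l \<partial>Rplus) = (\<integral>\<^sup>+l. indicator {0<..<b} l \<partial>Rplus)"
      by (intro nn_integral_cong) (auto simp: space_Rplus split: split_indicator)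
    also have "\<dots> = ennreal b"
      using that by (subst nn_integral_indicator) (auto simp: emeasure_Rplus_Ioo sets_restrict_space_iff)
    finally show ?thesis .
  qed
  have "(\<integral>\<^sup>+t. ennreal (norm (f t)) * k t \<partial>Rplus)
      = (\<integral>\<^sup>+t. \<integral>\<^sup>+l. k t * indicator {l. l < norm (f t)} l \<partial>Rplus \<partial>Rplus)"
    by (subst nn_integral_cmult) (simp_all add: layer mult.commute)
  also have "\<dots> = (\<integral>\<^sup>+l. \<integral>\<^sup>+t. k t * indicator {l. l < norm (f t)} l \<partial>Rplus \<partial>Rplus)"
    by (rule Rplus_pair.Fubini') measurable
  \<comment> \<open>The level set is cut down to the space so that it is a measurable set of
    \<open>Rplus\<close>, as \<open>bathtub\<close> requires.\<close>
  also have "\<dots> = (\<integral>\<^sup>+l. \<integral>\<^sup>+t. k t * indicator {t \<in> space Rplus. l < norm (f t)} t \<partial>Rplus \<partial>Rplus)"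
    by (intro nn_integral_cong) (auto simp: space_Rplus split: split_indicator)
  also have "\<dots> \<le> (\<integral>\<^sup>+l. \<integral>\<^sup>+t. k t * indicator {t. ennreal t < ?d l} t \<partial>Rplus \<partial>Rplus)"
    unfolding distribution_function_def by (intro nn_integral_mono bathtub k) measurable
  also have "\<dots> = (\<integral>\<^sup>+t. \<integral>\<^sup>+l. k t * indicator {t. ennreal t < ?d l} t \<partial>Rplus \<partial>Rplus)"
    by (rule Rplus_pair.Fubini') measurable
  also have "\<dots> = (\<integral>\<^sup>+t. k t * (\<integral>\<^sup>+l. indicator {t. ennreal t < ?d l} t \<partial>Rplus) \<partial>Rplus)"
    by (intro nn_integral_cong nn_integral_cmult) measurable
  also have "\<dots> \<le> (\<integral>\<^sup>+t. k t * decreasing_rearrangement f t \<partial>Rplus)"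
  proof (intro nn_integral_mono mult_left_mono)
    fix t
    show "(\<integral>\<^sup>+l. indicator {t. ennreal t < ?d l} t \<partial>Rplus) \<le> decreasing_rearrangement f t"
    proof (cases "decreasing_rearrangement f t" rule: ennreal_cases)
      case (real v)
      \<comment> \<open>All levels counted by the inner integral lie in \<open>{0<..v}\<close>, a
        set of measure \<open>v\<close>.\<close>
      have "l \<le> v" if "ennreal t < ?d l" for l
        using le_decreasing_rearrangement[OF f that] real by simp
      then have "(\<integral>\<^sup>+l. indicator {t. ennreal t < ?d l} t \<partial>Rplus)
          \<le> (\<integral>\<^sup>+l. indicator {0<..v} l \<partial>Rplus)"
        by (intro nn_integral_mono) (auto simp: space_Rplus split: split_indicator)
      also have "\<dots> = ennreal v"
        using real
        by (subst nn_integral_indicator) (auto simp: emeasure_Rplus_Ioc sets_restrict_space_iff)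
      finally show ?thesis
        using real by simp
    qed simp
  qed simp
  finally show ?thesis
    by (simp add: mult.commute)
qed

section \<open>Powers of extended nonnegative reals and Jensen's inequality\<close>

lemma borel_measurable_ennreal_powr [measurable]:
  "(\<lambda>x. ennreal_powr x a) \<in> borel_measurable borel"
  unfolding ennreal_powr_def by measurable

lemma ennreal_powr_ennreal: "0 \<le> x \<Longrightarrow> ennreal_powr (ennreal x) a = ennreal (x powr a)"
  by (simp add: ennreal_powr_def)

lemma ennreal_powr_top [simp]: "ennreal_powr top a = top"
  by (simp add: ennreal_powr_def)

lemma ennreal_powr_mono:
  assumes "x \<le> y" "0 \<le> a"
  shows "ennreal_powr x a \<le> ennreal_powr y a"
proof (cases y rule: ennreal_cases)
  case (real v)
  with assms obtain u where "x = ennreal u" "0 \<le> u"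
    by (metis ennreal_cases ennreal_less_top leD)
  with real assms show ?thesis
    by (simp add: ennreal_powr_ennreal powr_mono2 ennreal_leI)
qed simp

lemma ennreal_powr_mult:
  assumes "0 < c"
  shows "ennreal_powr (ennreal c * x) a = ennreal (c powr a) * ennreal_powr x a"
proof (cases x rule: ennreal_cases)
  case (real v)
  with assms show ?thesis
    by (simp add: ennreal_powr_ennreal powr_mult flip: ennreal_mult)
qed (use assms in \<open>simp add: ennreal_mult_top\<close>)

text \<open>The graph of the convex function \<open>x powr r\<close> lies above its tangent at
  \<open>A\<close>; the constant term is moved across so that every term is nonnegative and the
  inequality transfers to \<open>ennreal\<close>. It is Young's inequality for \<open>x\<close> and
  \<open>A powr (r - 1)\<close>.\<close>

lemma powr_tangent:
  fixes x A r :: real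
  assumes "0 \<le> x" "0 \<le> A" "1 \<le> r"
  shows "r * A powr (r - 1) * x \<le> x powr r + (r - 1) * A powr r"
proof (cases "r = 1")
  case False
  then have r: "1 < r" using assms by simp
  have "x * A powr (r - 1) \<le> x powr r / r + (A powr (r - 1)) powr (r / (r - 1)) / (r / (r - 1))"
    by (rule Youngs_inequality) (use r assms in \<open>auto simp: field_simps\<close>)
  also have "(A powr (r - 1)) powr (r / (r - 1)) = A powr r"
    using r by (simp add: powr_powr)
  also have "x powr r / r + A powr r / (r / (r - 1)) = (x powr r + (r - 1) * A powr r) / r"
    using r by (simp add: field_simps)
  finally show ?thesis
    using r by (simp add: field_simps)
\<comment> \<open>For \<open>r = 1\<close>, where the conjugate exponent degenerates, the claim is
  \<open>x \<le> x\<close>, or \<open>0 \<le> x\<close> when \<open>A = 0\<close> because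
  \<open>0 powr 0 = 0\<close>.\<close>
qed (use assms in auto)

lemma ennreal_powr_tangent:
  assumes "0 \<le> A" "1 \<le> r"
  shows "ennreal (r * A powr (r - 1)) * x \<le> ennreal_powr x r + ennreal ((r - 1) * A powr r)"
proof (cases x rule: ennreal_cases)
  case (real v)
  with assms powr_tangent[of v A r] show ?thesis
    by (simp add: ennreal_powr_ennreal ennreal_leI flip: ennreal_mult ennreal_plus)
qed simp

text \<open>Jensen's inequality without normalising the kernel to mass one: the tangent inequality
  is integrated against \<open>k\<close> and the point of tangency \<open>A\<close> is chosen
  afterwards.\<close>

lemma nn_integral_jensen_powr:
  assumes [measurable]: "u \<in> borel_measurable N" "k \<in> borel_measurable N"
    and M: "(\<integral>\<^sup>+t. k t \<partial>N) \<le> ennreal M" "0 < M" and r: "1 \<le> r"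
  shows "ennreal_powr (\<integral>\<^sup>+t. u t * k t \<partial>N) r
    \<le> ennreal (M powr (r - 1)) * (\<integral>\<^sup>+t. ennreal_powr (u t) r * k t \<partial>N)"
    (is "ennreal_powr ?I r \<le> _ * ?J")
proof -
  have tangent: "ennreal (r * A powr (r - 1)) * ?I \<le> ?J + ennreal ((r - 1) * A powr r * M)"
    if "0 \<le> A" for A
  proof -
    have "ennreal (r * A powr (r - 1)) * ?I = (\<integral>\<^sup>+t. ennreal (r * A powr (r - 1)) * u t * k t \<partial>N)"
      by (subst nn_integral_cmult[symmetric]) (simp_all add: mult.assoc)
    also have "\<dots> \<le> (\<integral>\<^sup>+t. (ennreal_powr (u t) r + ennreal ((r - 1) * A powr r)) * k t \<partial>N)"
      by (intro nn_integral_mono mult_right_mono ennreal_powr_tangent that r) simp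
    also have "\<dots> = ?J + ennreal ((r - 1) * A powr r) * (\<integral>\<^sup>+t. k t \<partial>N)"
      by (simp add: distrib_right nn_integral_add nn_integral_cmult)
    also have "\<dots> \<le> ?J + ennreal ((r - 1) * A powr r) * ennreal M"
      by (intro add_left_mono mult_left_mono M) simp
    finally show ?thesis
      using r M by (simp add: ennreal_mult)
  qed
  show ?thesis
  proof (cases ?I rule: ennreal_cases)
    case top
    \<comment> \<open>With an infinite left side, any tangent of positive slope forces
      \<open>?J\<close> to be infinite; \<open>A = 1\<close> will do.\<close>
    have "?J = top"
      using tangent[of 1] r by (simp add: top ennreal_mult_top top_unique)
    with M show ?thesis
      by (simp add: ennreal_mult_top)
  next
    case (real i)
    note i = this
    show ?thesis
    proof (cases ?J rule: ennreal_cases)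
      case top
      with M show ?thesis by (simp add: ennreal_mult_top)
    next
      case (real j)
      show ?thesis
      proof (cases "i = 0")
        case False
        with i have "0 < i" by simp
        \<comment> \<open>The choice \<open>A = i / M\<close> gives the sharpest of the tangent
          inequalities; it is the mean of \<open>u\<close> when \<open>k\<close> has mass exactly
          \<open>M\<close>.\<close>
        have "r * (i / M) powr (r - 1) * i \<le> j + (r - 1) * (i / M) powr r * M"
          using tangent[of "i / M"] real i r M
          by (simp flip: ennreal_mult ennreal_plus)
        moreover have "(i / M) powr r = i powr r / M powr r"
          "(i / M) powr (r - 1) = (i powr r / i) / (M powr r / M)"
          using \<open>0 < i\<close> M by (simp_all add: powr_divide powr_diff)
        ultimately have "M * i powr r \<le> M powr r * j"
          using \<open>0 < i\<close> M by (simp add: field_simps)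
        then have "i powr r \<le> M powr (r - 1) * j"
          using M by (simp add: powr_diff field_simps)
        then show ?thesis
          using i real by (simp add: ennreal_powr_ennreal ennreal_leI flip: ennreal_mult)
      qed (use i in \<open>simp add: ennreal_powr_def\<close>)
    qed
  qed
qed

section \<open>Weighted bounds for the real Laplace transform\<close>

text \<open>The measure \<open>dt/t\<close> is invariant under dilations, so the value does not
  depend on \<open>b\<close>; the substitution \<open>b * t\<close> reduces it to Euler's integral
  for \<open>Gamma s\<close>.\<close>

lemma nn_integral_Gamma_kernel:
  assumes "0 < s" "0 < b"
  shows "(\<integral>\<^sup>+t. ennreal ((b * t) powr s * exp (- (b * t)) / t) \<partial>Rplus) = ennreal (Gamma s)"
proof -
  let ?f = "\<lambda>t::real. indicator {0..} t * (t powr (s - 1) / exp t)"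
  have "ennreal (Gamma s) = (\<integral>\<^sup>+t. ennreal (?f t) \<partial>lborel)"
    by (rule nn_integral_has_integral_lebesgue[symmetric])
       (use assms Gamma_integral_real[of s] in auto)
  also have "\<dots> = ennreal b * (\<integral>\<^sup>+t. ennreal (?f (0 + b * t)) \<partial>lborel)"
    using assms by (subst nn_integral_real_affine[where c = b and t = 0]) auto
  also have "\<dots> = (\<integral>\<^sup>+t. ennreal (b * ?f (b * t)) \<partial>lborel)"
    using assms by (subst nn_integral_cmult[symmetric]) (auto simp: ac_simps simp flip: ennreal_mult')
  also have "\<dots> = (\<integral>\<^sup>+t. ennreal ((b * t) powr s * exp (- (b * t)) / t) * indicator {0<..} t \<partial>lborel)"
  proof (rule nn_integral_cong)
    fix t :: real
    \<comment> \<open>At \<open>t = 0\<close> the left side vanishes too, although the indicator of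
      \<open>{0..}\<close> is one there, because \<open>0 powr (s - 1) = 0\<close>.\<close>
    consider "t < 0" | "t = 0" | "0 < t" by linarith
    then show "ennreal (b * ?f (b * t)) = ennreal ((b * t) powr s * exp (- (b * t)) / t) * indicator {0<..} t"
    proof cases
      case 3
      with assms show ?thesis
        by (simp add: powr_diff exp_minus field_simps)
    qed (use assms in \<open>auto simp: zero_le_mult_iff\<close>)
  qed
  finally show ?thesis
    by (simp add: nn_integral_Rplus)
qed

text \<open>Values in \<open>ennreal\<close> allow any rearrangement as input, before convergence of
  the integral is known.\<close>

definition laplace_nn :: "(real \<Rightarrow> ennreal) \<Rightarrow> real \<Rightarrow> ennreal"
  where "laplace_nn u x = (\<integral>\<^sup>+t. u t * ennreal (exp (- (x * t))) \<partial>Rplus)"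

lemma antimono_laplace_nn: "antimono (laplace_nn u)"
  unfolding laplace_nn_def
  by (intro antimonoI nn_integral_mono mult_left_mono ennreal_leI) (auto simp: space_Rplus)

text \<open>On the multiplicative group with Haar measure \<open>dt/t\<close>, the weighted Laplace transform
  is the convolution of \<open>t powr (1 - s) * u t\<close> with the kernel \<open>y powr s * exp (- y)\<close>.\<close>

lemma laplace_nn_convolution:
  assumes "u \<in> borel_measurable Rplus" "0 < b"
  shows "ennreal (b powr s) * laplace_nn u b
    = (\<integral>\<^sup>+t. (ennreal (t powr (1 - s)) * u t) * ennreal ((b * t) powr s * exp (- (b * t)) / t) \<partial>Rplus)"
proof -
  have "ennreal (b powr s) * laplace_nn u b
      = (\<integral>\<^sup>+t. ennreal (b powr s) * (u t * ennreal (exp (- (b * t)))) \<partial>Rplus)"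
    unfolding laplace_nn_def using assms by (subst nn_integral_cmult) auto
  also have "\<dots> = (\<integral>\<^sup>+t. (ennreal (t powr (1 - s)) * u t) * ennreal ((b * t) powr s * exp (- (b * t)) / t) \<partial>Rplus)"
  proof (rule nn_integral_cong)
    fix t assume "t \<in> space Rplus"
    then have t: "0 < t" by (simp add: space_Rplus)
    then have "t powr (1 - s) * ((b * t) powr s * exp (- (b * t)) / t) = b powr s * exp (- (b * t))"
      using assms by (simp add: powr_mult powr_diff)
    then have "ennreal (t powr (1 - s)) * ennreal ((b * t) powr s * exp (- (b * t)) / t)
        = ennreal (b powr s) * ennreal (exp (- (b * t)))"
      using t by (simp flip: ennreal_mult)
    then show "ennreal (b powr s) * (u t * ennreal (exp (- (b * t))))
        = (ennreal (t powr (1 - s)) * u t) * ennreal ((b * t) powr s * exp (- (b * t)) / t)"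
      by (metis mult.assoc mult.commute)
  qed
  finally show ?thesis .
qed

text \<open>Moves the weight from \<open>x\<close> to \<open>a * x\<close>, the point where the
  transform is evaluated, so that a dilation by \<open>a\<close> costs only a constant.\<close>

lemma laplace_nn_rescale:
  assumes "0 < a" "0 < x"
  shows "ennreal (x powr s) * y = ennreal (a powr - s) * (ennreal ((a * x) powr s) * y)"
proof -
  have "x powr s = a powr - s * (a * x) powr s"
    using assms by (simp add: powr_mult powr_minus)
  then show ?thesis
    by (simp add: ennreal_mult mult.assoc)
qed

text \<open>The endpoint \<open>r = \<infinity>\<close> of Young's inequality: a bounded function
  convolved with a kernel of mass \<open>Gamma s\<close>.\<close>

lemma laplace_nn_sup_bound:
  assumes [measurable]: "u \<in> borel_measurable Rplus" and "0 < a" "0 < s" "0 < x"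
    and S: "\<And>t. 0 < t \<Longrightarrow> ennreal (t powr (1 - s)) * u t \<le> S"
  shows "ennreal (x powr s) * laplace_nn u (a * x) \<le> ennreal (a powr - s) * (S * ennreal (Gamma s))"
proof -
  have "ennreal ((a * x) powr s) * laplace_nn u (a * x)
      \<le> (\<integral>\<^sup>+t. S * ennreal ((a * x * t) powr s * exp (- (a * x * t)) / t) \<partial>Rplus)"
    using assms
    by (subst laplace_nn_convolution) (auto intro!: nn_integral_mono mult_right_mono simp: space_Rplus)
  also have "\<dots> = S * ennreal (Gamma s)"
    using assms by (simp add: nn_integral_cmult nn_integral_Gamma_kernel)
  finally show ?thesis
    using laplace_nn_rescale[of a x] assms by (simp add: mult_left_mono)
qed

text \<open>Young's inequality for finite \<open>r\<close>. Jensen's inequality in \<open>t\<close>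
  contributes \<open>Gamma s powr (r - 1)\<close>; after exchanging the integrals, the
  \<open>x\<close>-integral of the kernel contributes the last factor
  \<open>Gamma s\<close>.\<close>

lemma laplace_nn_powr_bound:
  assumes [measurable]: "u \<in> borel_measurable Rplus" and a: "0 < a" and s: "0 < s" and r: "1 \<le> r"
  shows "(\<integral>\<^sup>+x. ennreal_powr (ennreal (x powr s) * laplace_nn u (a * x)) r / ennreal x \<partial>Rplus)
    \<le> ennreal (a powr (- s * r) * Gamma s powr r)
      * (\<integral>\<^sup>+t. ennreal_powr (ennreal (t powr (1 - s)) * u t) r / ennreal t \<partial>Rplus)"
proof -
  \<comment> \<open>The factor \<open>1 / t\<close> of the multiplicative Haar measure is built into
    the kernel, since the integrals are taken with respect to \<open>dt\<close>.\<close>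
  define K where "K b t = (b * t) powr s * exp (- (b * t)) / t" for b t :: real
  define w where "w t = ennreal_powr (ennreal (t powr (1 - s)) * u t) r" for t
  \<comment> \<open>Collects the rescaling factor \<open>a powr - s\<close>, raised to the power
    \<open>r\<close>, and the factor from Jensen's inequality.\<close>
  define c where "c = a powr (- s * r) * Gamma s powr (r - 1)"
  have [measurable]: "w \<in> borel_measurable Rplus"
    unfolding w_def by measurable
  have G: "0 < Gamma s"
    using s by (rule Gamma_real_pos)
  have mass: "(\<integral>\<^sup>+t. ennreal (K b t) \<partial>Rplus) = ennreal (Gamma s)" if "0 < b" for b
    unfolding K_def using s that by (rule nn_integral_Gamma_kernel)
  have pointwise: "ennreal_powr (ennreal (x powr s) * laplace_nn u (a * x)) r / ennreal x
      \<le> (\<integral>\<^sup>+t. ennreal c * (w t / ennreal t * ennreal (K (a * t) x)) \<partial>Rplus)" if x: "0 < x" for x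
  proof -
    have K [measurable]: "(\<lambda>t. ennreal (K (a * x) t)) \<in> borel_measurable Rplus"
      unfolding K_def by measurable
    have "ennreal_powr (ennreal (x powr s) * laplace_nn u (a * x)) r
        = ennreal ((a powr - s) powr r)
          * ennreal_powr (\<integral>\<^sup>+t. (ennreal (t powr (1 - s)) * u t) * ennreal (K (a * x) t) \<partial>Rplus) r"
      using a x unfolding K_def
      by (subst laplace_nn_rescale[of a]) (simp_all add: ennreal_powr_mult laplace_nn_convolution)
    also have "\<dots> \<le> ennreal ((a powr - s) powr r)
        * (ennreal (Gamma s powr (r - 1)) * (\<integral>\<^sup>+t. w t * ennreal (K (a * x) t) \<partial>Rplus))"
      unfolding w_def
      by (intro mult_left_mono nn_integral_jensen_powr) (use a x G r mass in auto)
    also have "\<dots> = ennreal c * (\<integral>\<^sup>+t. w t * ennreal (K (a * x) t) \<partial>Rplus)"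
      by (simp add: c_def powr_powr ennreal_mult mult.assoc)
    finally have "ennreal_powr (ennreal (x powr s) * laplace_nn u (a * x)) r / ennreal x
        \<le> ennreal c * (\<integral>\<^sup>+t. w t * ennreal (K (a * x) t) \<partial>Rplus) / ennreal x"
      by (rule divide_right_mono_ennreal)
    also have "\<dots> = (\<integral>\<^sup>+t. ennreal c * (w t * ennreal (K (a * x) t)) / ennreal x \<partial>Rplus)"
      by (simp add: nn_integral_divide nn_integral_cmult)
    also have "\<dots> = (\<integral>\<^sup>+t. ennreal c * (w t / ennreal t * ennreal (K (a * t) x)) \<partial>Rplus)"
    proof (rule nn_integral_cong)
      fix t assume "t \<in> space Rplus"
      then have t: "0 < t" by (simp add: space_Rplus)
      \<comment> \<open>Up to the factors \<open>1 / t\<close> and \<open>1 / x\<close>, the kernel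
        depends only on the product \<open>a * x * t\<close>, hence the symmetry in \<open>x\<close>
        and \<open>t\<close>.\<close>
      have "K (a * x) t * (1 / x) = 1 / t * K (a * t) x"
        by (simp add: K_def ac_simps)
      then have "ennreal (K (a * x) t) * ennreal (1 / x) = ennreal (1 / t) * ennreal (K (a * t) x)"
        using t x by (simp add: K_def flip: ennreal_mult)
      then have "w t * (ennreal (K (a * x) t) * ennreal (1 / x)) = w t * (ennreal (1 / t) * ennreal (K (a * t) x))"
        by simp
      then show "ennreal c * (w t * ennreal (K (a * x) t)) / ennreal x
          = ennreal c * (w t / ennreal t * ennreal (K (a * t) x))"
        using t x by (simp add: divide_ennreal_def inverse_ennreal mult.assoc inverse_eq_divide)
    qed
    finally show ?thesis .
  qed
  have "(\<integral>\<^sup>+x. ennreal_powr (ennreal (x powr s) * laplace_nn u (a * x)) r / ennreal x \<partial>Rplus)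
      \<le> (\<integral>\<^sup>+x. \<integral>\<^sup>+t. ennreal c * (w t / ennreal t * ennreal (K (a * t) x)) \<partial>Rplus \<partial>Rplus)"
    by (intro nn_integral_mono pointwise) (simp add: space_Rplus)
  also have "\<dots> = (\<integral>\<^sup>+t. \<integral>\<^sup>+x. ennreal c * (w t / ennreal t * ennreal (K (a * t) x)) \<partial>Rplus \<partial>Rplus)"
    unfolding K_def by (rule Rplus_pair.Fubini') measurable
  also have "\<dots> = (\<integral>\<^sup>+t. ennreal c * (w t / ennreal t * ennreal (Gamma s)) \<partial>Rplus)"
  proof (rule nn_integral_cong)
    fix t assume "t \<in> space Rplus"
    then have "0 < a * t" using a by (simp add: space_Rplus)
    moreover have "(\<lambda>x. ennreal (K (a * t) x)) \<in> borel_measurable Rplus"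
      unfolding K_def by measurable
    ultimately show "(\<integral>\<^sup>+x. ennreal c * (w t / ennreal t * ennreal (K (a * t) x)) \<partial>Rplus)
        = ennreal c * (w t / ennreal t * ennreal (Gamma s))"
      by (simp add: nn_integral_cmult mass)
  qed
  also have "\<dots> = ennreal (c * Gamma s) * (\<integral>\<^sup>+t. w t / ennreal t \<partial>Rplus)"
    using G by (simp add: nn_integral_cmult nn_integral_multc ennreal_mult' mult_ac c_def)
  also have "c * Gamma s = a powr (- s * r) * Gamma s powr r"
    using G by (simp add: c_def powr_diff)
  finally show ?thesis
    by (simp add: w_def)
qed

section \<open>Decreasing majorants\<close>

text \<open>An infinite value at \<open>x\<close> would propagate to all smaller points and make the
  integrand infinite on \<open>{0<..<x}\<close>, a set of positive measure.\<close>

lemma antimono_finite_of_powr_integral: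
  assumes H: "antimono H" and "0 < x"
    and fin: "(\<integral>\<^sup>+x. ennreal_powr (ennreal (x powr s) * H x) r / ennreal x \<partial>Rplus) < \<infinity>"
  shows "H x < \<infinity>"
proof (rule ccontr)
  assume "\<not> H x < \<infinity>"
  then have "H x = top"
    by (simp flip: less_top)
  then have top: "H y = top" if "y \<le> x" for y
    using antimonoD[OF H that] by (simp add: top_unique)
  have "(\<infinity>::ennreal) = (\<integral>\<^sup>+y. \<infinity> * indicator {0<..<x} y \<partial>Rplus)"
    using \<open>0 < x\<close>
    by (subst nn_integral_cmult_indicator)
       (auto simp: emeasure_Rplus_Ioo sets_restrict_space_iff ennreal_top_mult)
  also have "\<dots> \<le> (\<integral>\<^sup>+y. ennreal_powr (ennreal (y powr s) * H y) r / ennreal y \<partial>Rplus)"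
    by (intro nn_integral_mono)
       (auto simp: top ennreal_mult_top ennreal_top_divide split: split_indicator)
  finally show False
    using fin by (simp add: top_unique)
qed

lemma decreasing_rearrangement_le:
  assumes H: "antimono H" and g: "\<And>x. 0 < x \<Longrightarrow> ennreal (norm (g x)) \<le> H x" and "0 < t"
  shows "decreasing_rearrangement g t \<le> H t"
proof (cases "H t" rule: ennreal_cases)
  case (real v)
  have "x < t" if "0 < x" "v < norm (g x)" for x
  proof (rule ccontr)
    assume "\<not> x < t"
    then have "ennreal (norm (g x)) \<le> H t"
      using g[OF that(1)] antimonoD[OF H, of t x] by simp
    with real that show False by simp
  qed
  then have "distribution_function g v \<le> emeasure Rplus {0<..<t}"
    unfolding distribution_function_def
    by (intro emeasure_mono) (auto simp: space_Rplus sets_restrict_space_iff)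
  also have "\<dots> = ennreal t"
    using \<open>0 < t\<close> by (simp add: emeasure_Rplus_Ioo)
  finally show ?thesis
    unfolding decreasing_rearrangement_def real using real by (intro Inf_lower) auto
qed simp

section \<open>The complex Laplace operator on Lorentz spaces\<close>

lemma norm_laplace_kernel: "norm (laplace_kernel \<theta> x t) = exp (- (cos \<theta> * x * t))"
  by (simp add: laplace_kernel_def norm_exp_eq_Re mult.assoc cis_conv_exp[symmetric] ac_simps)

text \<open>Joint measurability is what makes the parametrised integral \<open>laplace_op\<close>
  measurable in \<open>\<rho>\<close>.\<close>

lemma laplace_kernel_measurable [measurable]:
  "(\<lambda>(x, t). laplace_kernel \<theta> x t) \<in> borel_measurable (Rplus \<Otimes>\<^sub>M Rplus)"
  unfolding laplace_kernel_def by measurable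

lemma laplace_op_measurable:
  assumes [measurable]: "f \<in> borel_measurable Rplus"
  shows "laplace_op \<theta> f \<in> borel_measurable Rplus"
  unfolding laplace_op_def by measurable

text \<open>The modulus of the kernel is decreasing in \<open>t\<close> because
  \<open>cos \<theta>\<close> is nonnegative, so the Hardy--Littlewood inequality applies.\<close>

lemma nn_integral_laplace_kernel_le:
  assumes f: "f \<in> borel_measurable Rplus" and "0 \<le> cos \<theta>" "0 < x"
  shows "(\<integral>\<^sup>+t. ennreal (norm (f t * laplace_kernel \<theta> x t)) \<partial>Rplus)
    \<le> laplace_nn (decreasing_rearrangement f) (cos \<theta> * x)"
proof -
  have "antimono (\<lambda>t. ennreal (exp (- (cos \<theta> * x * t))))"
    using assms by (intro antimonoI ennreal_leI) (simp add: mult_left_mono)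
  from hardy_littlewood_antimono[OF f this] show ?thesis
    by (simp add: laplace_nn_def norm_mult norm_laplace_kernel ennreal_mult)
qed

theorem theorem3:
  fixes p p' \<theta> :: real and r :: ennreal
  assumes "p > 2" and "1 / p + 1 / p' = 1"
    and "- pi / 2 < \<theta>" and "\<theta> < pi / 2"
    and "1 \<le> r"
  shows "\<forall>f \<in> lorentz_space p r.
    (\<forall>\<rho>>0. integrable Rplus (\<lambda>t. f t * laplace_kernel \<theta> \<rho> t)) \<and>
    laplace_op \<theta> f \<in> lorentz_space p' r"
proof
  fix f assume f: "f \<in> lorentz_space p r"
  then have [measurable]: "f \<in> borel_measurable Rplus"
    by (simp add: lorentz_space_def)
  \<comment> \<open>This \<open>s\<close> is the target weight exponent, and conjugacy makes the
    source weight exponent \<open>1 - s\<close>, exactly the pair occurring in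
    \<open>laplace_nn_convolution\<close>.\<close>
  define s where "s = 1 / p'"
  have p: "1 / p = 1 - s"
    using assms by (simp add: s_def)
  moreover have "1 / p < 1"
    using assms by simp
  ultimately have s: "0 < s"
    by linarith
  have c: "0 < cos \<theta>"
    using assms by (intro cos_gt_zero_pi) auto
  define u where "u = decreasing_rearrangement f"
  define H where "H x = laplace_nn u (cos \<theta> * x)" for x
  have [measurable]: "u \<in> borel_measurable Rplus"
    unfolding u_def
    by (intro borel_measurable_Rplus borel_measurable_antimono_ennreal antimono_decreasing_rearrangement)
  have H: "antimono H"
    unfolding H_def using c by (intro antimonoI antimonoD[OF antimono_laplace_nn]) simp
  have r: "(r = \<infinity> \<and> (SUP t\<in>{0<..}. ennreal (t powr (1 - s)) * u t) < \<infinity>) \<or>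
    (r \<noteq> \<infinity> \<and> 1 \<le> enn2real r \<and>
      (\<integral>\<^sup>+t. ennreal_powr (ennreal (t powr (1 - s)) * u t) (enn2real r) / ennreal t \<partial>Rplus) < \<infinity>)"
  proof (cases r rule: ennreal_cases)
    case (real v)
    with f p assms(5) show ?thesis
      by (simp add: lorentz_space_def u_def)
  qed (use f p in \<open>simp add: lorentz_space_def u_def\<close>)
  \<comment> \<open>The majorant \<open>H\<close> satisfies the defining condition of the target
    space with \<open>H\<close> itself in place of a rearrangement.\<close>
  have H_lorentz: "(r = \<infinity> \<and> (SUP x\<in>{0<..}. ennreal (x powr s) * H x) < \<infinity>) \<or>
    (r \<noteq> \<infinity> \<and> 1 \<le> enn2real r \<and>
      (\<integral>\<^sup>+x. ennreal_powr (ennreal (x powr s) * H x) (enn2real r) / ennreal x \<partial>Rplus) < \<infinity>)"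
    using r
  proof (elim disjE conjE, goal_cases)
    case 1
    let ?S = "SUP t\<in>{0<..}. ennreal (t powr (1 - s)) * u t"
    have "(SUP x\<in>{0<..}. ennreal (x powr s) * H x) \<le> ennreal (cos \<theta> powr - s) * (?S * ennreal (Gamma s))"
      unfolding H_def using c s by (intro SUP_least laplace_nn_sup_bound) (auto intro: SUP_upper)
    also have "\<dots> < \<infinity>"
      using 1(2) by (simp add: ennreal_mult_less_top)
    finally show ?case
      using 1(1) by simp
  next
    case 2
    have "(\<integral>\<^sup>+x. ennreal_powr (ennreal (x powr s) * H x) (enn2real r) / ennreal x \<partial>Rplus)
        \<le> ennreal (cos \<theta> powr (- s * enn2real r) * Gamma s powr enn2real r)
          * (\<integral>\<^sup>+t. ennreal_powr (ennreal (t powr (1 - s)) * u t) (enn2real r) / ennreal t \<partial>Rplus)"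
      unfolding H_def using c s 2(2) by (intro laplace_nn_powr_bound) auto
    also have "\<dots> < \<infinity>"
      using 2(3) by (simp add: ennreal_mult_less_top)
    finally show ?case
      using 2(1,2) by simp
  qed
  \<comment> \<open>For \<open>r = \<infinity>\<close> finiteness is read off from the supremum; for
    finite \<open>r\<close> it comes from the integral and monotonicity.\<close>
  have H_finite: "H x < \<infinity>" if x: "0 < x" for x
    using H_lorentz
  proof (elim disjE conjE, goal_cases)
    case 1
    have "ennreal (x powr s) * H x < \<infinity>"
      by (rule le_less_trans[OF SUP_upper 1(2)]) (use x in simp)
    then show ?case
      using x by (auto simp: ennreal_mult_less_top)
  next
    case 2
    then show ?case
      using antimono_finite_of_powr_integral[OF H x] by blast
  qed
  \<comment> \<open>Absolute convergence ensures that \<open>laplace_op\<close> is a genuine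
    integral and not the default value \<open>0\<close> of a divergent one.\<close>
  have int: "integrable Rplus (\<lambda>t. f t * laplace_kernel \<theta> x t)" if x: "0 < x" for x
  proof (rule integrableI_bounded)
    have "(\<lambda>t. laplace_kernel \<theta> x t) \<in> borel_measurable Rplus"
      unfolding laplace_kernel_def by measurable
    then show "(\<lambda>t. f t * laplace_kernel \<theta> x t) \<in> borel_measurable Rplus"
      by measurable
    show "(\<integral>\<^sup>+t. ennreal (norm (f t * laplace_kernel \<theta> x t)) \<partial>Rplus) < \<infinity>"
      using nn_integral_laplace_kernel_le[of f \<theta> x] c x H_finite[OF x]
      by (auto simp: H_def u_def intro: le_less_trans)
  qed
  have "ennreal (norm (laplace_op \<theta> f x)) \<le> H x" if x: "0 < x" for x
    unfolding laplace_op_def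
    using integral_norm_bound_ennreal[OF int[OF x]] nn_integral_laplace_kernel_le[of f \<theta> x] c x
    by (auto simp: H_def u_def intro: order_trans)
  then have rearr: "decreasing_rearrangement (laplace_op \<theta> f) x \<le> H x" if "0 < x" for x
    using decreasing_rearrangement_le[OF H _ that] by blast
  have "laplace_op \<theta> f \<in> lorentz_space p' r"
    using H_lorentz
  proof (elim disjE conjE, goal_cases)
    case 1
    have "(SUP x\<in>{0<..}. ennreal (x powr s) * decreasing_rearrangement (laplace_op \<theta> f) x)
        \<le> (SUP x\<in>{0<..}. ennreal (x powr s) * H x)"
      by (intro SUP_mono) (auto intro!: bexI mult_left_mono rearr)
    then show ?case
      using 1 by (auto simp: lorentz_space_def s_def laplace_op_measurable intro: le_less_trans)
  next
    case 2
    have "(\<integral>\<^sup>+x. ennreal_powr (ennreal (x powr s) * decreasing_rearrangement (laplace_op \<theta> f) x) (enn2real r)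
          / ennreal x \<partial>Rplus)
        \<le> (\<integral>\<^sup>+x. ennreal_powr (ennreal (x powr s) * H x) (enn2real r) / ennreal x \<partial>Rplus)"
      using 2(2)
      by (intro nn_integral_mono divide_right_mono_ennreal ennreal_powr_mono mult_left_mono rearr)
         (auto simp: space_Rplus)
    then show ?case
      using 2 by (auto simp: lorentz_space_def s_def laplace_op_measurable intro: le_less_trans)
  qed
  with int show "(\<forall>\<rho>>0. integrable Rplus (\<lambda>t. f t * laplace_kernel \<theta> \<rho> t)) \<and>
    laplace_op \<theta> f \<in> lorentz_space p' r"
    by blast
qed

end
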